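(* Let $(X,d)$ be a complete CAT(0) space and let $T_1, T_2 : X \to X$ be mappings satisfying property $(P_2)$. Let $\lambda \in (0,1)$ and let $T : X \to X$ be defined by $Tx := (1-\lambda)T_1x + \lambda T_2x$ for all $x \in X$. Assume that $Fix(T) \neq \emptyset$. Then for any $x \in X$, the Picard iteration $(T^nx)_{n}$ of $T$ starting with $x$ $\Delta$-converges to a fixed point of $T$.
   Context: A geodesic joining $x,y$ in a metric space $(X,d)$ is a map $\gamma:[0,1]\to X$ with $\gamma(0)=x$, $\gamma(1)=y$ and $d(\gamma(t),\gamma(t'))=|t-t'|\,d(x,y)$ for all $t,t'\in[0,1]$; $(X,d)$ is geodesic if any two points are joined by a geodesic. A CAT(0) space is a geodesic space such that for every geodesic $\gamma:[0,1]\to X$, every $z\in X$ and $t\in[0,1]$, $d^2(z,\gamma(t))\le (1-t)d^2(z,\gamma(0))+t\,d^2(z,\gamma(1))-t(1-t)d^2(\gamma(0),\gamma(1))$. Geodesics in a CAT(0) space are unique, and $(1-t)x+ty$ denotes the point $\gamma(t)$ on the unique geodesic $\gamma$ joining $x$ to $y$. A mapping $T:X\to X$ satisfies property $(P_2)$ if for all $x,y\in X$, $2d^2(Tx,Ty)\le d^2(x,Ty)+d^2(y,Tx)-d^2(x,Tx)-d^2(y,Ty)$. $Fix(T)$ denotes the set of fixed points of $T$. For a bounded sequence $(x_n)$ in a complete CAT(0) space $X$, put $r((x_n)):=\inf_{y\in X}\limsup_{n\to\infty}d(y,x_n)$ and $A((x_n)):=\{c\in X\mid \limsup_{n\to\infty}d(c,x_n)=r((x_n))\}$,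 the set of asymptotic centers of $(x_n)$ (it is known that it is always a singleton). A bounded sequence $(x_n)$ $\Delta$-converges to $x\in X$ if for every subsequence $(x_{n_k})$ of $(x_n)$, $A((x_{n_k}))=\{x\}$. *)

theory Defs
  imports "HOL-Analysis.Analysis"
begin

text \<open>A path is a total function on the reals; only its values on the unit interval matter.\<close>

definition (in metric_space) geodesic_joining :: "(real \<Rightarrow> 'a) \<Rightarrow> 'a \<Rightarrow> 'a \<Rightarrow> bool" where
  "geodesic_joining \<gamma> x y \<longleftrightarrow>
     \<gamma> 0 = x \<and> \<gamma> 1 = y \<and>
     (\<forall>t\<in>{0..1}. \<forall>t'\<in>{0..1}. dist (\<gamma> t) (\<gamma> t') = \<bar>t - t'\<bar> * dist x y)"

class cat0_space = metric_space +
  assumes geodesic_exists: "\<exists>\<gamma>. geodesic_joining \<gamma> x y"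
    and cat0_inequality:
      "geodesic_joining \<gamma> x y \<Longrightarrow> 0 \<le> t \<Longrightarrow> t \<le> 1 \<Longrightarrow>
        (dist z (\<gamma> t))\<^sup>2 \<le>
          (1 - t) * (dist z (\<gamma> 0))\<^sup>2 + t * (dist z (\<gamma> 1))\<^sup>2 - t * (1 - t) * (dist (\<gamma> 0) (\<gamma> 1))\<^sup>2"

lemma geodesic_unique:
  fixes x y :: "'a::cat0_space"
  assumes g: "geodesic_joining \<gamma> x y" and h: "geodesic_joining \<gamma>' x y"
    and t: "0 \<le> t" "t \<le> 1"
  shows "\<gamma> t = \<gamma>' t"
proof -
  have ends: "\<gamma> 0 = x" "\<gamma> 1 = y" "\<gamma>' 0 = x" "\<gamma>' 1 = y"
    using g h unfolding geodesic_joining_def by blast+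
  have dist_eq: "dist (\<gamma>' t) (\<gamma>' s) = \<bar>t - s\<bar> * dist x y" if "s \<in> {0..1}" for s
    using h t that by (simp add: geodesic_joining_def)
  have d: "dist (\<gamma>' t) x = t * dist x y" "dist (\<gamma>' t) y = (1 - t) * dist x y"
    using dist_eq[of 0] dist_eq[of 1] t unfolding ends by simp_all
  have "(dist (\<gamma>' t) (\<gamma> t))\<^sup>2 \<le>
      (1 - t) * (t * dist x y)\<^sup>2 + t * ((1 - t) * dist x y)\<^sup>2 - t * (1 - t) * (dist x y)\<^sup>2"
    using cat0_inequality[OF g t, of "\<gamma>' t"] by (simp only: ends d)
  also have "\<dots> = 0"
    by (simp add: power2_eq_square algebra_simps)
  finally show ?thesis by simp
qed

text \<open>The point written \<open>(1 - t) x + t y\<close>; it is specified only for \<open>t\<close> in the unit interval.\<close>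

definition geodesic_comb :: "real \<Rightarrow> 'a::cat0_space \<Rightarrow> 'a \<Rightarrow> 'a" where
  "geodesic_comb t x y = (THE z. \<exists>\<gamma>. geodesic_joining \<gamma> x y \<and> z = \<gamma> t)"

lemma geodesic_comb_eq:
  assumes "geodesic_joining \<gamma> x y" "0 \<le> t" "t \<le> 1"
  shows "geodesic_comb t x y = \<gamma> t"
  unfolding geodesic_comb_def
proof (rule the_equality)
  show "\<exists>\<gamma>'. geodesic_joining \<gamma>' x y \<and> \<gamma> t = \<gamma>' t"
    using assms(1) by (intro exI[of _ \<gamma>] conjI refl)
next
  fix z assume "\<exists>\<gamma>'. geodesic_joining \<gamma>' x y \<and> z = \<gamma>' t"
  then obtain \<gamma>' where "geodesic_joining \<gamma>' x y" "z = \<gamma>' t" by (elim exE conjE)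
  then show "z = \<gamma> t" using geodesic_unique[OF _ assms] by simp
qed

definition property_P2 :: "('a::metric_space \<Rightarrow> 'a) \<Rightarrow> bool" where
  "property_P2 T \<longleftrightarrow>
     (\<forall>x y. 2 * (dist (T x) (T y))\<^sup>2 \<le>
        (dist x (T y))\<^sup>2 + (dist y (T x))\<^sup>2 - (dist x (T x))\<^sup>2 - (dist y (T y))\<^sup>2)"

definition Fix :: "('a \<Rightarrow> 'a) \<Rightarrow> 'a set" where
  "Fix T = {x. T x = x}"

text \<open>The radius and the limits superior are taken in the extended reals, because the library's
  \<^const>\<open>Limsup\<close> needs a complete lattice; for bounded sequences all these values are finite.\<close>

definition asymptotic_radius :: "(nat \<Rightarrow> 'a::metric_space) \<Rightarrow> ereal" where
  "asymptotic_radius x = (INF y. limsup (\<lambda>n. ereal (dist y (x n))))"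

definition asymptotic_centers :: "(nat \<Rightarrow> 'a::metric_space) \<Rightarrow> 'a set" where
  "asymptotic_centers x = {c. limsup (\<lambda>n. ereal (dist c (x n))) = asymptotic_radius x}"

definition Delta_converges :: "(nat \<Rightarrow> 'a::metric_space) \<Rightarrow> 'a \<Rightarrow> bool" where
  "Delta_converges x p \<longleftrightarrow>
     bounded (range x) \<and>
     (\<forall>k :: nat \<Rightarrow> nat. strict_mono k \<longrightarrow> asymptotic_centers (x \<circ> k) = {p})"

end

theory Submission
  imports Defs
begin

text \<open>
  Since \<open>T\<^sub>1\<close> and \<open>T\<^sub>2\<close> may have no common fixed point, a fixed point of \<open>T\<close> says nothing directly
  about either map. The average is therefore read as a composition on \<open>X \<times> X\<close>, with squared
  distance \<open>(1 - \<lambda>) d(u\<^sub>1, v\<^sub>1)\<^sup>2 + \<lambda> d(u\<^sub>2, v\<^sub>2)\<^sup>2\<close>: the diagonal point \<open>(x, x)\<close> goes to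
  \<open>(T\<^sub>1 x, T\<^sub>2 x)\<close>, and then the nearest-point projection onto the diagonal, which is the weighted
  barycentre, produces \<open>(T x, T x)\<close>. Both steps satisfy the inequality of property \<open>(P\<^sub>2)\<close> for the
  product distance (\<open>firm_product_map\<close>, \<open>firm_barycentre\<close>).

  Let \<open>z\<^sub>0, z\<^sub>1, \<dots>\<close> be the resulting alternating orbit and \<open>\<rho>\<close> the product distance.
  The four-point inequality
  \<open>\<rho>(a, c)\<^sup>2 + \<rho>(b, d)\<^sup>2 - \<rho>(a, b)\<^sup>2 - \<rho>(c, d)\<^sup>2 \<le> 2 \<rho>(a, d) \<rho>(b, c)\<close>, a Cauchy-Schwarz inequality for
  the quasi-inner product of a CAT(0) space, turns \<open>(P\<^sub>2)\<close> into nonexpansiveness, so the limits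
  \<open>e\<^sub>k\<close> of \<open>\<rho>(z\<^sub>m, z\<^bsub>m+2k\<^esub>)\<close> as \<open>m\<close> grows exist. The inequality \<open>(P\<^sub>2)\<close> bounds these even-step
  distances in terms of odd-step ones, whose limits need not exist; adding it for two successive
  values of \<open>m\<close> arranges the odd-step terms so that the four-point inequality bounds them by
  even-step distances again. What remains is \<open>2 e\<^bsub>k+1\<^esub> \<le> e\<^sub>k + e\<^bsub>k+2\<^esub>\<close>. A convex sequence with
  \<open>e\<^sub>0 = 0\<close> satisfies \<open>e\<^sub>k \<ge> k e\<^sub>1\<close>, and a fixed point of \<open>T\<close> keeps the orbit bounded; hence
  \<open>e\<^sub>1 = 0\<close>, that is, \<open>d(T\<^sup>n x, T\<^sup>n\<^sup>+\<^sup>1 x)\<close> tends to \<open>0\<close>.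

  The rest is the classical argument for asymptotically regular nonexpansive maps. A subsequence
  of the orbit has exactly one asymptotic center, which \<open>T\<close> maps to an asymptotic center and thus
  fixes. The distances from the orbit to a fixed point decrease, so passing to a subsequence does
  not change their limit superior, and all subsequences have the same center.
\<close>

section \<open>Convex combinations and the four-point inequality\<close>

lemma geodesic_comb_inequality:
  fixes a b z :: "'a::cat0_space"
  assumes "0 \<le> t" "t \<le> 1"
  shows "(dist z (geodesic_comb t a b))\<^sup>2 \<le>
    (1 - t) * (dist z a)\<^sup>2 + t * (dist z b)\<^sup>2 - t * (1 - t) * (dist a b)\<^sup>2"
proof -
  obtain \<gamma> where g: "geodesic_joining \<gamma> a b" using geodesic_exists by blast
  then have "\<gamma> 0 = a" "\<gamma> 1 = b" by (auto simp: geodesic_joining_def)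
  then show ?thesis
    using cat0_inequality[OF g assms, of z] geodesic_comb_eq[OF g assms] by simp
qed

lemma dist_geodesic_comb:
  fixes a b :: "'a::cat0_space"
  assumes "0 \<le> t" "t \<le> 1"
  shows "dist a (geodesic_comb t a b) = t * dist a b"
    and "dist b (geodesic_comb t a b) = (1 - t) * dist a b"
proof -
  obtain \<gamma> where g: "geodesic_joining \<gamma> a b" using geodesic_exists by blast
  then have ends: "\<gamma> 0 = a" "\<gamma> 1 = b"
    and d: "\<And>s. s \<in> {0..1} \<Longrightarrow> dist (\<gamma> s) (\<gamma> t) = \<bar>s - t\<bar> * dist a b"
    using assms by (auto simp: geodesic_joining_def)
  show "dist a (geodesic_comb t a b) = t * dist a b"
    "dist b (geodesic_comb t a b) = (1 - t) * dist a b"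
    using d[of 0] d[of 1] assms ends geodesic_comb_eq[OF g assms] by simp_all
qed

text \<open>Convexity of the square, applied to \<open>u / (1 - t)\<close> and \<open>v / t\<close> with weights \<open>1 - t\<close> and \<open>t\<close>.\<close>

lemma square_of_sum_le:
  fixes u v t :: real
  assumes "0 < t" "t < 1"
  shows "(u + v)\<^sup>2 \<le> u\<^sup>2 / (1 - t) + v\<^sup>2 / t"
proof -
  have "u\<^sup>2 / (1 - t) + v\<^sup>2 / t - (u + v)\<^sup>2 = (t * u - (1 - t) * v)\<^sup>2 / (t * (1 - t))"
    using assms by (simp add: field_simps power2_eq_square)
  moreover have "0 \<le> (t * u - (1 - t) * v)\<^sup>2 / (t * (1 - t))"
    using assms by simp
  ultimately show ?thesis by linarith
qed

text \<open>
  The Cauchy-Schwarz inequality of Berg and Nikolaev. The diagonal from \<open>b\<close> to \<open>d\<close> is compared with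
  the detour through a point \<open>m\<close> of the diagonal from \<open>a\<close> to \<open>c\<close>. Splitting the square of the
  detour with weights \<open>1 - t\<close> and \<open>t\<close>, where \<open>t\<close> is the parameter of \<open>m\<close>, reproduces the terms
  \<open>d(a, b)\<^sup>2\<close>, \<open>d(c, d)\<^sup>2\<close> and \<open>d(a, c)\<^sup>2\<close> with coefficient one and leaves
  \<open>t / (1 - t) d(b, c)\<^sup>2 + (1 - t) / t d(a, d)\<^sup>2\<close>.
\<close>

lemma cat0_four_point:
  fixes a b c d :: "'a::cat0_space"
  shows "(dist a c)\<^sup>2 + (dist b d)\<^sup>2 - (dist a b)\<^sup>2 - (dist c d)\<^sup>2 \<le> 2 * dist a d * dist b c"
proof (cases "a = d \<or> b = c")
  case True
  then show ?thesis by (auto simp: dist_commute)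
next
  case False
  (* the parameter for which t / (1 - t) = d(a, d) / d(b, c), the minimiser of the two terms left over *)
  define t where "t = dist a d / (dist a d + dist b c)"
  define m where "m = geodesic_comb t a c"
  have pos: "0 < dist a d" "0 < dist b c" using False by auto
  have t: "0 < t" "t < 1" using pos by (auto simp: t_def field_simps add_pos_pos)
  have sum_pos: "0 < dist a d + dist b c" using pos by (rule add_pos_pos)
  have t1: "1 - t = dist b c / (dist a d + dist b c)"
    using sum_pos by (simp add: t_def diff_divide_eq_iff)
  have ratio: "t / (1 - t) = dist a d / dist b c" "(1 - t) / t = dist b c / dist a d"
    using sum_pos unfolding t1 unfolding t_def by simp_all
  have B: "(dist b m)\<^sup>2 \<le> (1 - t) * (dist a b)\<^sup>2 + t * (dist b c)\<^sup>2 - t * (1 - t) * (dist a c)\<^sup>2"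
    using geodesic_comb_inequality[of t b a c] t by (simp add: m_def dist_commute)
  have D: "(dist d m)\<^sup>2 \<le> (1 - t) * (dist a d)\<^sup>2 + t * (dist c d)\<^sup>2 - t * (1 - t) * (dist a c)\<^sup>2"
    using geodesic_comb_inequality[of t d a c] t by (simp add: m_def dist_commute)
  have "(dist b d)\<^sup>2 \<le> (dist b m + dist d m)\<^sup>2"
    using dist_triangle2[of b d m] by (intro power_mono) auto
  also have "\<dots> \<le> (dist b m)\<^sup>2 / (1 - t) + (dist d m)\<^sup>2 / t"
    by (rule square_of_sum_le[OF t])
  also have "\<dots> \<le> ((1 - t) * (dist a b)\<^sup>2 + t * (dist b c)\<^sup>2 - t * (1 - t) * (dist a c)\<^sup>2) / (1 - t)
      + ((1 - t) * (dist a d)\<^sup>2 + t * (dist c d)\<^sup>2 - t * (1 - t) * (dist a c)\<^sup>2) / t"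
    using B D t by (intro add_mono divide_right_mono) auto
  also have "\<dots> = (dist a b)\<^sup>2 + (dist c d)\<^sup>2 - (dist a c)\<^sup>2
      + (t / (1 - t)) * (dist b c)\<^sup>2 + ((1 - t) / t) * (dist a d)\<^sup>2"
    using t by (simp add: field_simps)
  also have "\<dots> = (dist a b)\<^sup>2 + (dist c d)\<^sup>2 - (dist a c)\<^sup>2 + 2 * dist a d * dist b c"
    using pos unfolding ratio by (simp add: power2_eq_square field_simps)
  finally show ?thesis by simp
qed

section \<open>Alternating firm steps are asymptotically regular\<close>

text \<open>
  Unlike the CAT(0) inequality, which speaks of geodesics, the four-point inequality involves only
  distances, so it passes to weighted products by summation and the Cauchy-Schwarz inequality. It is
  the form in which curvature enters the argument below.
\<close>

locale four_point_distance =
  fixes \<rho> :: "'b \<Rightarrow> 'b \<Rightarrow> real"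
  assumes nonneg: "0 \<le> \<rho> u v"
    and self: "\<rho> u u = 0"
    and commute: "\<rho> u v = \<rho> v u"
    and four_point: "(\<rho> a c)\<^sup>2 + (\<rho> b d)\<^sup>2 - (\<rho> a b)\<^sup>2 - (\<rho> c d)\<^sup>2 \<le> 2 * \<rho> a d * \<rho> b c"
begin

text \<open>
  The inequality of property \<open>(P\<^sub>2)\<close> for one pair of points \<open>u, v\<close> and their images \<open>u', v'\<close>.
  Speaking of points instead of a map lets two different maps act in turn.
\<close>

definition firm :: "'b \<Rightarrow> 'b \<Rightarrow> 'b \<Rightarrow> 'b \<Rightarrow> bool" where
  "firm u v u' v' \<longleftrightarrow>
     2 * (\<rho> u' v')\<^sup>2 \<le> (\<rho> u v')\<^sup>2 + (\<rho> v u')\<^sup>2 - (\<rho> u u')\<^sup>2 - (\<rho> v v')\<^sup>2"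

lemma firm_nonexpansive:
  assumes "firm u v u' v'"
  shows "\<rho> u' v' \<le> \<rho> u v"
proof (cases "\<rho> u' v' = 0")
  case True
  then show ?thesis using nonneg by simp
next
  case False
  then have pos: "0 < \<rho> u' v'" using nonneg[of u' v'] by simp
  have "2 * (\<rho> u' v')\<^sup>2 \<le> 2 * \<rho> u v * \<rho> u' v'"
    using assms four_point[of u v' u' v] by (simp add: firm_def commute)
  then show ?thesis using pos by (simp add: power2_eq_square)
qed

text \<open>
  Firmness at \<open>m\<close> and at \<open>m + 1\<close> is added. In the sum the one-step distances match those of two
  instances of the four-point inequality, one with outer points \<open>z\<^sub>m, z\<^bsub>m+2k+4\<^esub>\<close> and inner points
  \<open>z\<^bsub>m+1\<^esub>, z\<^bsub>m+2k+3\<^esub>\<close>, the other with outer points \<open>z\<^bsub>m+1\<^esub>, z\<^bsub>m+2k+3\<^esub>\<close> and inner points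
  \<open>z\<^bsub>m+2\<^esub>, z\<^bsub>m+2k+2\<^esub>\<close>, so every distance over an odd number of steps cancels.
\<close>

lemma alternating_convexity:
  assumes firm: "\<And>m k. firm (z m) (z (m + 2 * k)) (z (Suc m)) (z (Suc (m + 2 * k)))"
  shows "(\<rho> (z (Suc m)) (z (Suc m + 2 * Suc k)))\<^sup>2
       + (\<rho> (z (Suc (Suc m))) (z (Suc (Suc m) + 2 * Suc k)))\<^sup>2
    \<le> \<rho> (z (Suc m)) (z (Suc m + 2 * Suc k)) *
       (\<rho> (z (Suc (Suc m))) (z (Suc (Suc m) + 2 * k)) + \<rho> (z m) (z (m + 2 * Suc (Suc k))))"
proof -
  note P = firm[of m "Suc k", unfolded firm_def] firm[of "Suc m" "Suc k", unfolded firm_def]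
  note Q = four_point[of "z m" "z (Suc m + 2 * Suc k)" "z (Suc m)" "z (m + 2 * Suc (Suc k))"]
    four_point[of "z (Suc m)" "z (m + 2 * Suc k)" "z (Suc (Suc m))" "z (Suc m + 2 * Suc k)"]
  show ?thesis
    using P Q by (simp add: algebra_simps commute)
qed

text \<open>
  In the limit \<open>alternating_convexity\<close> says that \<open>e k\<close>, the limiting distance over \<open>2 k\<close> steps, is
  convex in \<open>k\<close>. As \<open>e 0 = 0\<close> it grows at least linearly with slope \<open>e 1\<close>, and a bounded sequence
  leaves only \<open>e 1 = 0\<close>.
\<close>

lemma alternating_asymptotic_regularity:
  assumes firm: "\<And>m k. firm (z m) (z (m + 2 * k)) (z (Suc m)) (z (Suc (m + 2 * k)))"
    and bound: "\<And>k. \<rho> (z 0) (z (2 * k)) \<le> B"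
  shows "(\<lambda>m. \<rho> (z m) (z (m + 2))) \<longlonglongrightarrow> 0"
proof -
  define u where "u k m = \<rho> (z m) (z (m + 2 * k))" for k m
  have dec: "decseq (u k)" for k
    using firm_nonexpansive[OF firm] by (auto simp: decseq_Suc_iff u_def)
  have ge0: "0 \<le> u k m" for k m by (simp add: u_def nonneg)
  have "\<exists>l. u k \<longlonglongrightarrow> l" for k
    using decseq_convergent[OF dec[of k], of 0] ge0 by metis
  then obtain e where e: "\<And>k. u k \<longlonglongrightarrow> e k" by metis
  have e_ge0: "0 \<le> e k" for k by (rule LIMSEQ_le_const[OF e]) (use ge0 in auto)
  have e_le: "e k \<le> B" for k
  proof -
    have "e k \<le> u k 0" by (rule decseq_ge[OF dec e])
    then show ?thesis using bound[of k] by (simp add: u_def)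
  qed
  have "u 0 = (\<lambda>m. 0)" by (simp add: fun_eq_iff u_def self)
  then have e_0: "e 0 = 0" using e[of 0] by (simp add: LIMSEQ_const_iff)
  have convex: "2 * e (Suc k) \<le> e k + e (Suc (Suc k))" for k
  proof -
    have shift1: "(\<lambda>m. u j (Suc m)) \<longlonglongrightarrow> e j"
      and shift2: "(\<lambda>m. u j (Suc (Suc m))) \<longlonglongrightarrow> e j" for j
      using LIMSEQ_Suc[OF e[of j]] LIMSEQ_Suc[OF LIMSEQ_Suc[OF e[of j]]] by simp_all
    have "(e (Suc k))\<^sup>2 + (e (Suc k))\<^sup>2 \<le> e (Suc k) * (e k + e (Suc (Suc k)))"
    proof (rule LIMSEQ_le)
      show "(\<lambda>m. (u (Suc k) (Suc m))\<^sup>2 + (u (Suc k) (Suc (Suc m)))\<^sup>2)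
          \<longlonglongrightarrow> (e (Suc k))\<^sup>2 + (e (Suc k))\<^sup>2"
        by (intro tendsto_intros shift1 shift2)
      show "(\<lambda>m. u (Suc k) (Suc m) * (u k (Suc (Suc m)) + u (Suc (Suc k)) m))
          \<longlonglongrightarrow> e (Suc k) * (e k + e (Suc (Suc k)))"
        by (intro tendsto_intros shift1 shift2 e)
      show "\<exists>N. \<forall>m\<ge>N. (u (Suc k) (Suc m))\<^sup>2 + (u (Suc k) (Suc (Suc m)))\<^sup>2
          \<le> u (Suc k) (Suc m) * (u k (Suc (Suc m)) + u (Suc (Suc k)) m)"
        unfolding u_def using alternating_convexity[where z = z, OF firm] by blast
    qed
    then have "e (Suc k) * (2 * e (Suc k)) \<le> e (Suc k) * (e k + e (Suc (Suc k)))"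
      by (simp add: power2_eq_square)
    then show ?thesis
      using e_ge0[of k] e_ge0[of "Suc k"] e_ge0[of "Suc (Suc k)"]
      by (cases "e (Suc k) = 0") auto
  qed
  have increment: "e 1 \<le> e (Suc k) - e k" for k
  proof (induction k)
    case 0
    then show ?case by (simp add: e_0)
  next
    case (Suc k)
    then show ?case using convex[of k] by simp
  qed
  have linear: "real k * e 1 \<le> e k" for k
  proof (induction k)
    case 0
    then show ?case by (simp add: e_0)
  next
    case (Suc k)
    then show ?case using increment[of k] by (simp add: algebra_simps)
  qed
  have "e 1 = 0"
  proof (rule ccontr)
    assume "e 1 \<noteq> 0"
    then have "0 < e 1" using e_ge0[of 1] by simp
    then obtain k :: nat where "B < real k * e 1" using reals_Archimedean3 by blast
    then show False using linear[of k] e_le[of k] by simp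
  qed
  then show ?thesis using e[of 1] by (simp add: u_def[abs_def])
qed

end

section \<open>The weighted product distance\<close>

definition wdist :: "real \<Rightarrow> 'a::metric_space \<times> 'a \<Rightarrow> 'a \<times> 'a \<Rightarrow> real" where
  "wdist t u v = sqrt ((1 - t) * (dist (fst u) (fst v))\<^sup>2 + t * (dist (snd u) (snd v))\<^sup>2)"

lemma wdist_square:
  assumes "0 \<le> t" "t \<le> 1"
  shows "(wdist t u v)\<^sup>2 = (1 - t) * (dist (fst u) (fst v))\<^sup>2 + t * (dist (snd u) (snd v))\<^sup>2"
  using assms by (simp add: wdist_def)

lemma wdist_diagonal:
  shows "wdist t (x, x) (y, y) = dist x y"
  by (simp add: wdist_def flip: distrib_right)

lemma weighted_cauchy_schwarz:
  fixes p q r s t :: real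
  assumes t: "0 \<le> t" "t \<le> 1"
  shows "(1 - t) * (p * q) + t * (r * s)
    \<le> sqrt ((1 - t) * p\<^sup>2 + t * r\<^sup>2) * sqrt ((1 - t) * q\<^sup>2 + t * s\<^sup>2)"
proof -
  have "((1 - t) * p\<^sup>2 + t * r\<^sup>2) * ((1 - t) * q\<^sup>2 + t * s\<^sup>2) - ((1 - t) * (p * q) + t * (r * s))\<^sup>2
      = t * (1 - t) * (p * s - q * r)\<^sup>2"
    by (simp add: power2_eq_square algebra_simps)
  moreover have "0 \<le> t * (1 - t) * (p * s - q * r)\<^sup>2" using t by simp
  ultimately have "((1 - t) * (p * q) + t * (r * s))\<^sup>2
      \<le> ((1 - t) * p\<^sup>2 + t * r\<^sup>2) * ((1 - t) * q\<^sup>2 + t * s\<^sup>2)" by linarith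
  then show ?thesis
    by (simp add: real_le_rsqrt flip: real_sqrt_mult)
qed

lemma wdist_four_point_distance:
  assumes t: "0 \<le> t" "t \<le> 1"
  shows "four_point_distance (wdist t :: 'a::cat0_space \<times> 'a \<Rightarrow> _)"
proof
  fix a b c d u v :: "'a \<times> 'a"
  show "0 \<le> wdist t u v" using t by (simp add: wdist_def)
  show "wdist t u u = 0" by (simp add: wdist_def)
  show "wdist t u v = wdist t v u" by (simp add: wdist_def dist_commute)
  have "(1 - t) * ((dist (fst a) (fst c))\<^sup>2 + (dist (fst b) (fst d))\<^sup>2
          - (dist (fst a) (fst b))\<^sup>2 - (dist (fst c) (fst d))\<^sup>2)
      + t * ((dist (snd a) (snd c))\<^sup>2 + (dist (snd b) (snd d))\<^sup>2
          - (dist (snd a) (snd b))\<^sup>2 - (dist (snd c) (snd d))\<^sup>2)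
      \<le> (1 - t) * (2 * dist (fst a) (fst d) * dist (fst b) (fst c))
        + t * (2 * dist (snd a) (snd d) * dist (snd b) (snd c))"
    using t by (intro add_mono mult_left_mono cat0_four_point) auto
  also have "\<dots> = 2 * ((1 - t) * (dist (fst a) (fst d) * dist (fst b) (fst c))
        + t * (dist (snd a) (snd d) * dist (snd b) (snd c)))"
    by (simp add: algebra_simps)
  also have "\<dots> \<le> 2 * (wdist t a d * wdist t b c)"
    unfolding wdist_def by (intro mult_left_mono weighted_cauchy_schwarz t) simp
  finally show "(wdist t a c)\<^sup>2 + (wdist t b d)\<^sup>2 - (wdist t a b)\<^sup>2 - (wdist t c d)\<^sup>2
      \<le> 2 * wdist t a d * wdist t b c"
    using t by (simp add: wdist_square algebra_simps)
qed

text \<open>On the diagonal, firmness of the product map is the weighted sum of the two given inequalities.\<close>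

lemma firm_product_map:
  fixes T\<^sub>1 T\<^sub>2 :: "'a::cat0_space \<Rightarrow> 'a"
  assumes t: "0 \<le> t" "t \<le> 1" and T: "property_P2 T\<^sub>1" "property_P2 T\<^sub>2"
  shows "four_point_distance.firm (wdist t) (x, x) (y, y) (T\<^sub>1 x, T\<^sub>2 x) (T\<^sub>1 y, T\<^sub>2 y)"
proof -
  interpret four_point_distance "wdist t :: 'a \<times> 'a \<Rightarrow> _"
    by (rule wdist_four_point_distance[OF t])
  have "(1 - t) * (2 * (dist (T\<^sub>1 x) (T\<^sub>1 y))\<^sup>2) + t * (2 * (dist (T\<^sub>2 x) (T\<^sub>2 y))\<^sup>2)
    \<le> (1 - t) * ((dist x (T\<^sub>1 y))\<^sup>2 + (dist y (T\<^sub>1 x))\<^sup>2 - (dist x (T\<^sub>1 x))\<^sup>2 - (dist y (T\<^sub>1 y))\<^sup>2)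
      + t * ((dist x (T\<^sub>2 y))\<^sup>2 + (dist y (T\<^sub>2 x))\<^sup>2 - (dist x (T\<^sub>2 x))\<^sup>2 - (dist y (T\<^sub>2 y))\<^sup>2)"
    using T t unfolding property_P2_def by (intro add_mono mult_left_mono) auto
  then show ?thesis
    using t by (simp add: firm_def wdist_square algebra_simps)
qed

text \<open>
  The CAT(0) inequality is the obtuse-angle property
  \<open>\<rho>((z, z), Q u)\<^sup>2 \<le> \<rho>(u, (z, z))\<^sup>2 - \<rho>(u, Q u)\<^sup>2\<close> of the projection \<open>Q\<close> onto the diagonal: its
  subtracted term \<open>t (1 - t) d(u\<^sub>1, u\<^sub>2)\<^sup>2\<close> is the squared distance from \<open>u\<close> to \<open>Q u\<close>. Taking for
  \<open>(z, z)\<close> the projection of the other point and adding gives firmness.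
\<close>

lemma firm_barycentre:
  fixes u v :: "'a::cat0_space \<times> 'a"
  assumes t: "0 \<le> t" "t \<le> 1"
  defines "Q \<equiv> \<lambda>u. (geodesic_comb t (fst u) (snd u), geodesic_comb t (fst u) (snd u))"
  shows "four_point_distance.firm (wdist t) u v (Q u) (Q v)"
proof -
  interpret four_point_distance "wdist t :: 'a \<times> 'a \<Rightarrow> _"
    by (rule wdist_four_point_distance[OF t])
  have projection: "(wdist t (z, z) (Q u))\<^sup>2 \<le> (wdist t u (z, z))\<^sup>2 - (wdist t u (Q u))\<^sup>2" for z u
  proof -
    have "(wdist t u (Q u))\<^sup>2
        = (1 - t) * (t * dist (fst u) (snd u))\<^sup>2 + t * ((1 - t) * dist (fst u) (snd u))\<^sup>2"
      using t by (simp add: wdist_square Q_def dist_geodesic_comb)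
    then have "(wdist t u (Q u))\<^sup>2 = t * (1 - t) * (dist (fst u) (snd u))\<^sup>2"
      by (simp add: power2_eq_square algebra_simps)
    then show ?thesis
      using geodesic_comb_inequality[OF t, of z "fst u" "snd u"] t
      unfolding Q_def wdist_diagonal by (simp add: wdist_square dist_commute)
  qed
  show ?thesis
    using projection[of "fst (Q v)" u] projection[of "fst (Q u)" v]
    unfolding firm_def by (simp add: Q_def commute)
qed

section \<open>Averages of two maps with property \<open>(P\<^sub>2)\<close>\<close>

lemma average_nonexpansive:
  fixes T\<^sub>1 T\<^sub>2 :: "'a::cat0_space \<Rightarrow> 'a"
  assumes t: "0 \<le> t" "t \<le> 1" and T: "property_P2 T\<^sub>1" "property_P2 T\<^sub>2"
  shows "dist (geodesic_comb t (T\<^sub>1 x) (T\<^sub>2 x)) (geodesic_comb t (T\<^sub>1 y) (T\<^sub>2 y)) \<le> dist x y"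
proof -
  interpret four_point_distance "wdist t :: 'a \<times> 'a \<Rightarrow> _"
    by (rule wdist_four_point_distance[OF t])
  show ?thesis
    using firm_nonexpansive[OF firm_barycentre[OF t, of "(T\<^sub>1 x, T\<^sub>2 x)" "(T\<^sub>1 y, T\<^sub>2 y)"]]
      firm_nonexpansive[OF firm_product_map[OF t T, of x y]]
    by (simp add: wdist_diagonal)
qed

lemma average_asymptotically_regular:
  fixes T\<^sub>1 T\<^sub>2 :: "'a::cat0_space \<Rightarrow> 'a"
  assumes t: "0 \<le> t" "t \<le> 1" and T: "property_P2 T\<^sub>1" "property_P2 T\<^sub>2"
    and step: "\<And>n. x (Suc n) = geodesic_comb t (T\<^sub>1 (x n)) (T\<^sub>2 (x n))"
    and bounded: "bounded (range x)"
  shows "(\<lambda>n. dist (x n) (x (Suc n))) \<longlonglongrightarrow> 0"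
proof -
  interpret four_point_distance "wdist t :: 'a \<times> 'a \<Rightarrow> _"
    by (rule wdist_four_point_distance[OF t])
  (* the orbit of (x 0, x 0) under the product map and the barycentre projection in turn *)
  define z where "z m = (if even m then (x (m div 2), x (m div 2))
    else (T\<^sub>1 (x (m div 2)), T\<^sub>2 (x (m div 2))))" for m
  have z_even: "z (2 * n) = (x n, x n)" for n by (simp add: z_def)
  have z_odd: "z (Suc (2 * n)) = (T\<^sub>1 (x n), T\<^sub>2 (x n))" for n by (simp add: z_def)
  obtain B where B: "\<And>n. dist (x 0) (x n) \<le> B"
    using bounded unfolding bounded_any_center[where a = "x 0"] by auto
  have "(\<lambda>m. wdist t (z m) (z (m + 2))) \<longlonglongrightarrow> 0"
  proof (rule alternating_asymptotic_regularity)
    fix m k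
    show "firm (z m) (z (m + 2 * k)) (z (Suc m)) (z (Suc (m + 2 * k)))"
    proof (cases "even m")
      case True
      then obtain n where m: "m = 2 * n" by (elim evenE)
      have mk: "m + 2 * k = 2 * (n + k)" by (simp add: m)
      show ?thesis
        unfolding mk unfolding m z_even z_odd by (rule firm_product_map[OF t T])
    next
      case False
      then obtain n where m: "m = Suc (2 * n)" by (elim oddE) simp
      have mk: "m + 2 * k = Suc (2 * (n + k))" and S: "\<And>j. Suc (Suc (2 * j)) = 2 * Suc j"
        by (simp_all add: m)
      show ?thesis
        unfolding mk unfolding m S z_even z_odd step
        using firm_barycentre[OF t, of "(T\<^sub>1 (x n), T\<^sub>2 (x n))" "(T\<^sub>1 (x (n + k)), T\<^sub>2 (x (n + k)))"]
        by simp
    qed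
  next
    fix k
    show "wdist t (z 0) (z (2 * k)) \<le> B"
      using B[of k] z_even[of 0] by (simp add: z_even wdist_diagonal)
  qed
  then have "(\<lambda>n. wdist t (z (2 * n)) (z (2 * n + 2))) \<longlonglongrightarrow> 0"
    by (rule LIMSEQ_subseq_LIMSEQ[where f = "\<lambda>n. 2 * n", unfolded o_def])
      (simp add: strict_mono_def)
  moreover have "z (2 * n + 2) = (x (Suc n), x (Suc n))" for n
    using z_even[of "Suc n"] by simp
  ultimately show ?thesis by (simp add: z_even wdist_diagonal)
qed

section \<open>Asymptotic centers in complete CAT(0) spaces\<close>

lemma limsup_le_real_iff:
  fixes f :: "nat \<Rightarrow> real"
  shows "limsup (\<lambda>n. ereal (f n)) \<le> ereal r \<longleftrightarrow> (\<forall>s>r. \<forall>\<^sub>F n in sequentially. f n \<le> s)"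
    (is "?L \<longleftrightarrow> ?R")
proof
  assume L: ?L
  show ?R
  proof (intro allI impI)
    fix s assume "r < s"
    then have "limsup (\<lambda>n. ereal (f n)) < ereal s" using L le_less_trans by fastforce
    then have "\<forall>\<^sub>F n in sequentially. ereal (f n) < ereal s" by (rule Limsup_lessD)
    then show "\<forall>\<^sub>F n in sequentially. f n \<le> s" by (rule eventually_mono) simp
  qed
next
  assume R: ?R
  show ?L
  proof (rule ereal_le_epsilon2)
    fix e :: real assume "0 < e"
    then have "\<forall>\<^sub>F n in sequentially. f n \<le> r + e" using R by simp
    then have "limsup (\<lambda>n. ereal (f n)) \<le> ereal (r + e)"
      by (intro Limsup_bounded) (auto elim: eventually_mono)
    then show "limsup (\<lambda>n. ereal (f n)) \<le> ereal r + ereal e" by simp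
  qed
qed

lemma limsup_real_mono_perturbed:
  fixes f g h :: "nat \<Rightarrow> real"
  assumes "\<And>n. f n \<le> g n + h n" "h \<longlonglongrightarrow> 0"
  shows "limsup (\<lambda>n. ereal (f n)) \<le> limsup (\<lambda>n. ereal (g n))"
proof -
  have h: "limsup (\<lambda>n. ereal (h n)) = 0"
    using assms(2) by (intro lim_imp_Limsup) (simp_all add: zero_ereal_def)
  have "limsup (\<lambda>n. ereal (f n)) \<le> limsup (\<lambda>n. ereal (g n) + ereal (h n))"
    by (rule Limsup_mono) (simp add: assms(1))
  also have "\<dots> \<le> limsup (\<lambda>n. ereal (g n)) + limsup (\<lambda>n. ereal (h n))"
    by (rule ereal_limsup_add_mono)
  finally show ?thesis by (simp add: h)
qed

lemma asymptotic_radius_finite: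
  fixes x :: "nat \<Rightarrow> 'a::metric_space"
  assumes "bounded (range x)"
  obtains R where "0 \<le> R" "asymptotic_radius x = ereal R"
proof -
  obtain B where B: "\<And>n. dist (x 0) (x n) \<le> B"
    using assms unfolding bounded_any_center[where a = "x 0"] by auto
  have "asymptotic_radius x \<le> limsup (\<lambda>n. ereal (dist (x 0) (x n)))"
    unfolding asymptotic_radius_def by (rule INF_lower) simp
  also have "\<dots> \<le> ereal B" by (rule Limsup_bounded) (simp add: B)
  finally have upper: "asymptotic_radius x \<le> ereal B" .
  have "0 \<le> asymptotic_radius x"
    unfolding asymptotic_radius_def
    by (intro INF_greatest le_Limsup) (auto simp: zero_ereal_def)
  then show thesis using upper that by (cases "asymptotic_radius x") auto
qed

text \<open>
  By the CAT(0) inequality the midpoint of \<open>y\<close> and \<open>z\<close> is eventually closer to the sequence than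
  \<open>r\<close>, by an amount controlled by \<open>d(y, z)\<close>; but it cannot beat the asymptotic radius. This single
  estimate gives both uniqueness of centers and the Cauchy property of minimizing sequences.
\<close>

lemma near_centers_close:
  fixes x :: "nat \<Rightarrow> 'a::cat0_space"
  assumes R: "asymptotic_radius x = ereal R" "0 \<le> R"
    and y: "\<forall>\<^sub>F n in sequentially. dist y (x n) \<le> r"
    and z: "\<forall>\<^sub>F n in sequentially. dist z (x n) \<le> r"
  shows "(dist y z)\<^sup>2 \<le> 4 * (r\<^sup>2 - R\<^sup>2)"
proof -
  define m where "m = geodesic_comb (1/2) y z"
  define s where "s = sqrt (r\<^sup>2 - (dist y z)\<^sup>2 / 4)"
  have mid: "\<forall>\<^sub>F n in sequentially. (dist m (x n))\<^sup>2 \<le> r\<^sup>2 - (dist y z)\<^sup>2 / 4"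
    using y z
  proof eventually_elim
    case (elim n)
    have "(dist y (x n))\<^sup>2 \<le> r\<^sup>2" "(dist z (x n))\<^sup>2 \<le> r\<^sup>2"
      using elim by (simp_all add: power_mono)
    then show ?case
      using geodesic_comb_inequality[of "1/2" "x n" y z]
      by (simp add: m_def dist_commute)
  qed
  then have "\<forall>\<^sub>F n in sequentially. dist m (x n) \<le> s"
    by (rule eventually_mono) (simp add: s_def real_le_rsqrt)
  then have "limsup (\<lambda>n. ereal (dist m (x n))) \<le> ereal s"
    by (intro Limsup_bounded) (auto elim: eventually_mono)
  moreover have "asymptotic_radius x \<le> limsup (\<lambda>n. ereal (dist m (x n)))"
    unfolding asymptotic_radius_def by (rule INF_lower) simp
  ultimately have "ereal R \<le> ereal s" using R(1) by (metis order_trans)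
  then have "R\<^sup>2 \<le> s\<^sup>2" using R(2) by (simp add: power_mono)
  moreover have "0 \<le> r\<^sup>2 - (dist y z)\<^sup>2 / 4"
  proof -
    obtain n where "(dist m (x n))\<^sup>2 \<le> r\<^sup>2 - (dist y z)\<^sup>2 / 4"
      using eventually_happens[OF mid] by auto
    then show ?thesis by (rule order_trans[OF zero_le_power2])
  qed
  ultimately show ?thesis by (simp add: s_def)
qed

lemma asymptotic_center_unique:
  fixes x :: "nat \<Rightarrow> 'a::cat0_space"
  assumes "bounded (range x)" "c \<in> asymptotic_centers x" "c' \<in> asymptotic_centers x"
  shows "c = c'"
proof -
  obtain R where R: "0 \<le> R" "asymptotic_radius x = ereal R"
    using asymptotic_radius_finite[OF assms(1)] .
  have near: "\<forall>\<^sub>F n in sequentially. dist y (x n) \<le> s"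
    if "y \<in> asymptotic_centers x" "R < s" for y s
    using that R limsup_le_real_iff[of "\<lambda>n. dist y (x n)" R]
    by (simp add: asymptotic_centers_def)
  have "(dist c c')\<^sup>2 \<le> 4 * (s\<^sup>2 - R\<^sup>2)" if "R < s" for s
    using near_centers_close[OF R(2,1) near near] assms(2,3) that by blast
  then have "\<forall>\<^sub>F s in at_right R. (dist c c')\<^sup>2 \<le> 4 * (s\<^sup>2 - R\<^sup>2)"
    by (auto simp: eventually_at_filter)
  moreover have "((\<lambda>s. 4 * (s\<^sup>2 - R\<^sup>2)) \<longlongrightarrow> 4 * (R\<^sup>2 - R\<^sup>2)) (at_right R)"
    by (intro tendsto_intros)
  ultimately have "(dist c c')\<^sup>2 \<le> 4 * (R\<^sup>2 - R\<^sup>2)"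
    by (intro tendsto_lowerbound[where F = "at_right R"]) auto
  then show ?thesis by simp
qed

lemma asymptotic_center_exists:
  fixes x :: "nat \<Rightarrow> 'a::{cat0_space, complete_space}"
  assumes "bounded (range x)"
  shows "\<exists>c. c \<in> asymptotic_centers x"
proof -
  obtain R where R: "0 \<le> R" "asymptotic_radius x = ereal R"
    using asymptotic_radius_finite[OF assms] .
  define s where "s j = R + inverse (real (Suc j))" for j
  have s_lim: "s \<longlonglongrightarrow> R"
    using tendsto_add[OF tendsto_const[of R] LIMSEQ_inverse_real_of_nat] by (simp add: s_def[abs_def])
  have s_dec: "s k \<le> s j" if "j \<le> k" for j k
    using that by (simp add: s_def)
  have "\<exists>y. \<forall>\<^sub>F n in sequentially. dist y (x n) \<le> s j" for j
  proof -
    have "asymptotic_radius x < ereal (s j)" by (simp add: R s_def)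
    then obtain y where "limsup (\<lambda>n. ereal (dist y (x n))) < ereal (s j)"
      unfolding asymptotic_radius_def by (auto simp: INF_less_iff)
    then have "\<forall>\<^sub>F n in sequentially. ereal (dist y (x n)) < ereal (s j)"
      by (rule Limsup_lessD)
    then show ?thesis by (intro exI[of _ y]) (auto elim: eventually_mono)
  qed
  then obtain y where y: "\<And>j. \<forall>\<^sub>F n in sequentially. dist (y j) (x n) \<le> s j" by metis
  have near: "\<forall>\<^sub>F n in sequentially. dist (y k) (x n) \<le> s j" if "j \<le> k" for j k
    using y[of k] by (rule eventually_mono) (use s_dec[OF that] in simp)
  have close: "(dist (y j) (y k))\<^sup>2 \<le> 4 * ((s i)\<^sup>2 - R\<^sup>2)" if "i \<le> j" "i \<le> k" for i j k
    by (rule near_centers_close[OF R(2,1) near[OF that(1)] near[OF that(2)]])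
  have "Cauchy y"
  proof (rule metric_CauchyI)
    fix e :: real assume "0 < e"
    have "(\<lambda>i. 4 * ((s i)\<^sup>2 - R\<^sup>2)) \<longlonglongrightarrow> 4 * (R\<^sup>2 - R\<^sup>2)"
      by (intro tendsto_intros s_lim)
    then have "\<forall>\<^sub>F i in sequentially. 4 * ((s i)\<^sup>2 - R\<^sup>2) < e\<^sup>2"
      by (rule order_tendstoD) (use \<open>0 < e\<close> in simp)
    then obtain i where i: "4 * ((s i)\<^sup>2 - R\<^sup>2) < e\<^sup>2"
      using eventually_happens by fastforce
    have "dist (y j) (y k) < e" if "i \<le> j" "i \<le> k" for j k
      using close[OF that] i \<open>0 < e\<close> by (intro power2_less_imp_less[of _ e]) auto
    then show "\<exists>M. \<forall>j\<ge>M. \<forall>k\<ge>M. dist (y j) (y k) < e" by blast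
  qed
  then obtain c where c: "y \<longlonglongrightarrow> c" using Cauchy_convergent convergent_def by blast
  have "\<forall>\<^sub>F n in sequentially. dist c (x n) \<le> r" if "R < r" for r
  proof -
    have "(\<lambda>j. dist c (y j) + s j) \<longlonglongrightarrow> dist c c + R"
      by (intro tendsto_intros c s_lim)
    then have "\<forall>\<^sub>F j in sequentially. dist c (y j) + s j < r"
      by (rule order_tendstoD) (use that in simp)
    then obtain j where j: "dist c (y j) + s j < r"
      using eventually_happens by fastforce
    show ?thesis
      using y[of j]
    proof eventually_elim
      case (elim n)
      then show ?case using dist_triangle[of c "x n" "y j"] j by simp
    qed
  qed
  then have "limsup (\<lambda>n. ereal (dist c (x n))) \<le> asymptotic_radius x"
    by (simp add: R limsup_le_real_iff)
  moreover have "asymptotic_radius x \<le> limsup (\<lambda>n. ereal (dist c (x n)))"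
    unfolding asymptotic_radius_def by (rule INF_lower) simp
  ultimately show ?thesis by (auto simp: asymptotic_centers_def intro: antisym)
qed

lemma asymptotic_centers_iff:
  "c \<in> asymptotic_centers x \<longleftrightarrow>
    (\<forall>y. limsup (\<lambda>n. ereal (dist c (x n))) \<le> limsup (\<lambda>n. ereal (dist y (x n))))"
proof
  assume "c \<in> asymptotic_centers x"
  then show "\<forall>y. limsup (\<lambda>n. ereal (dist c (x n))) \<le> limsup (\<lambda>n. ereal (dist y (x n)))"
    by (auto simp: asymptotic_centers_def asymptotic_radius_def intro: INF_lower)
next
  assume "\<forall>y. limsup (\<lambda>n. ereal (dist c (x n))) \<le> limsup (\<lambda>n. ereal (dist y (x n)))"
  then have "limsup (\<lambda>n. ereal (dist c (x n))) \<le> asymptotic_radius x"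
    unfolding asymptotic_radius_def by (intro INF_greatest) auto
  moreover have "asymptotic_radius x \<le> limsup (\<lambda>n. ereal (dist c (x n)))"
    unfolding asymptotic_radius_def by (rule INF_lower) simp
  ultimately show "c \<in> asymptotic_centers x"
    by (auto simp: asymptotic_centers_def intro: antisym)
qed

section \<open>Delta-convergence of Picard iterations\<close>

text \<open>
  If \<open>x n\<close> is almost fixed, then \<open>T c\<close> is asymptotically at most as far from \<open>x n\<close> as \<open>c\<close> is, so it
  is a center as well.
\<close>

lemma asymptotic_center_fixed:
  fixes x :: "nat \<Rightarrow> 'a::cat0_space"
  assumes nonexp: "\<And>u v. dist (T u) (T v) \<le> dist u v"
    and approx: "(\<lambda>n. dist (x n) (T (x n))) \<longlonglongrightarrow> 0"
    and bounded: "bounded (range x)"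
    and c: "c \<in> asymptotic_centers x"
  shows "c \<in> Fix T"
proof -
  have le: "dist (T c) (x n) \<le> dist c (x n) + dist (x n) (T (x n))" for n
    using dist_triangle2[of "T c" "x n" "T (x n)"] nonexp[of c "x n"] by linarith
  have "limsup (\<lambda>n. ereal (dist (T c) (x n))) \<le> limsup (\<lambda>n. ereal (dist c (x n)))"
    by (rule limsup_real_mono_perturbed[OF le approx])
  then have "T c \<in> asymptotic_centers x"
    using c unfolding asymptotic_centers_iff by (meson order_trans)
  then have "T c = c" using asymptotic_center_unique[OF bounded] c by blast
  then show ?thesis by (simp add: Fix_def)
qed

text \<open>
  Let \<open>p\<close> be the center of the whole orbit and \<open>c\<close> that of a subsequence. Both are fixed points, so
  the comparison of \<open>p\<close> with \<open>c\<close> along the whole orbit carries over to the subsequence, where it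
  makes \<open>p\<close> a center too.
\<close>

lemma Delta_converges_picard:
  fixes T :: "'a::{cat0_space, complete_space} \<Rightarrow> 'a"
  assumes nonexp: "\<And>u v. dist (T u) (T v) \<le> dist u v"
    and regular: "(\<lambda>n. dist ((T ^^ n) x) ((T ^^ Suc n) x)) \<longlonglongrightarrow> 0"
    and bounded: "bounded (range (\<lambda>n. (T ^^ n) x))"
  shows "\<exists>p\<in>Fix T. Delta_converges (\<lambda>n. (T ^^ n) x) p"
proof -
  define X where "X n = (T ^^ n) x" for n
  have X_Suc: "X (Suc n) = T (X n)" for n by (simp add: X_def)
  have bounded_sub: "bounded (range (X \<circ> k))" for k :: "nat \<Rightarrow> nat"
    using bounded by (rule bounded_subset) (auto simp: X_def)
  have approx_sub: "(\<lambda>n. dist ((X \<circ> k) n) (T ((X \<circ> k) n))) \<longlonglongrightarrow> 0" if "strict_mono k" for k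
    using LIMSEQ_subseq_LIMSEQ[OF regular that] by (simp add: X_def o_def)
  have fixed: "c \<in> Fix T" if "strict_mono k" "c \<in> asymptotic_centers (X \<circ> k)" for k c
    by (rule asymptotic_center_fixed[OF nonexp approx_sub[OF that(1)] bounded_sub that(2)])
  have limsup_sub: "limsup (\<lambda>n. ereal (dist q ((X \<circ> k) n))) = limsup (\<lambda>n. ereal (dist q (X n)))"
    if q: "q \<in> Fix T" and k: "strict_mono k" for q k
  proof -
    have "decseq (\<lambda>n. dist q (X n))"
      using nonexp[of q] q by (simp add: decseq_Suc_iff X_Suc Fix_def)
    then obtain l where l: "(\<lambda>n. dist q (X n)) \<longlonglongrightarrow> l"
      using decseq_convergent[of "\<lambda>n. dist q (X n)" 0] by auto
    have "limsup (\<lambda>n. ereal (dist q (X n))) = ereal l"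
      using l by (intro lim_imp_Limsup) auto
    moreover have "limsup (\<lambda>n. ereal (dist q ((X \<circ> k) n))) = ereal l"
      using LIMSEQ_subseq_LIMSEQ[OF l k] by (intro lim_imp_Limsup) (auto simp: o_def)
    ultimately show ?thesis by simp
  qed
  have id: "X \<circ> id = X" "strict_mono (id :: nat \<Rightarrow> nat)" by (simp_all add: strict_mono_def)
  obtain p where p: "p \<in> asymptotic_centers X"
    using asymptotic_center_exists[OF bounded_sub[of id]] by (auto simp: id)
  have pF: "p \<in> Fix T" using fixed[of id p] p id by simp
  have "asymptotic_centers (X \<circ> k) = {p}" if k: "strict_mono k" for k
  proof -
    obtain c where c: "c \<in> asymptotic_centers (X \<circ> k)"
      using asymptotic_center_exists[OF bounded_sub] by blast
    have cF: "c \<in> Fix T" by (rule fixed[OF k c])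
    have "limsup (\<lambda>n. ereal (dist p ((X \<circ> k) n))) \<le> limsup (\<lambda>n. ereal (dist c ((X \<circ> k) n)))"
      using p unfolding limsup_sub[OF pF k] limsup_sub[OF cF k] asymptotic_centers_iff by blast
    then have "p \<in> asymptotic_centers (X \<circ> k)"
      using c unfolding asymptotic_centers_iff by (meson order_trans)
    then show ?thesis using asymptotic_center_unique[OF bounded_sub] by blast
  qed
  then have "Delta_converges X p"
    using bounded by (auto simp: Delta_converges_def X_def[abs_def])
  then show ?thesis using pF by (auto simp: X_def[abs_def])
qed

theorem theorem3p4:
  fixes T\<^sub>1 T\<^sub>2 T :: "'a::{cat0_space, complete_space} \<Rightarrow> 'a"
    and lam :: real
  assumes "property_P2 T\<^sub>1"
    and "property_P2 T\<^sub>2"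
    and "0 < lam" and "lam < 1"
    and "\<And>x. T x = geodesic_comb lam (T\<^sub>1 x) (T\<^sub>2 x)"
    and "Fix T \<noteq> {}"
  shows "\<forall>x. \<exists>p\<in>Fix T. Delta_converges (\<lambda>n. (T ^^ n) x) p"
proof
  fix x
  have lam: "0 \<le> lam" "lam \<le> 1" using assms(3,4) by simp_all
  have nonexp: "dist (T u) (T v) \<le> dist u v" for u v
    unfolding assms(5) by (rule average_nonexpansive[OF lam assms(1,2)])
  obtain q where q: "T q = q" using assms(6) by (auto simp: Fix_def)
  have "dist q ((T ^^ n) x) \<le> dist q x" for n
  proof (induction n)
    case (Suc n)
    then show ?case using nonexp[of q "(T ^^ n) x"] q by simp
  qed simp
  then have bounded: "bounded (range (\<lambda>n. (T ^^ n) x))"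
    unfolding bounded_def by blast
  have "(\<lambda>n. dist ((T ^^ n) x) ((T ^^ Suc n) x)) \<longlonglongrightarrow> 0"
    by (rule average_asymptotically_regular[OF lam assms(1,2) _ bounded]) (simp add: assms(5))
  then show "\<exists>p\<in>Fix T. Delta_converges (\<lambda>n. (T ^^ n) x) p"
    by (rule Delta_converges_picard[OF nonexp _ bounded])
qed

end
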